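(* Let $m \geq n \geq 1$ be integers, and let $\kappa$ be a positive integer with $\lceil \frac{m}{n} \rceil \leq \kappa < m$. Let $\Omega_m^{n,\kappa}$ be the number of ways to distribute $m$ identical balls into $n$ distinct boxes (empty boxes allowed) so that each box contains at most $\kappa$ balls, and let $P_m^{n,\kappa}$ be the probability that a distribution chosen uniformly at random among all distributions of $m$ identical balls into $n$ distinct boxes has at most $\kappa$ balls in each box. Then $$\Omega_m^{n, \kappa} = \binom{m+n-1}{n-1} - \sum_{\alpha=1}^{\lfloor \frac{m}{\kappa+1} \rfloor} (-1)^{\alpha+1} \binom{n}{\alpha} \binom{m-\alpha (\kappa+1)+n-1}{n-1}$$ and $$P_m^{n,\kappa} = 1 - \frac{\sum_{\alpha=1}^{\lfloor \frac{m}{\kappa+1} \rfloor} (-1)^{\alpha+1} \binom{n}{\alpha} \binom{m-\alpha (\kappa+1)+n-1}{n-1}}{\binom{m+n-1}{n-1}}.$$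
   Context: A distribution of $m$ identical balls into $n$ distinct boxes is an $n$-tuple $(X_1,\dots,X_n)$ of nonnegative integers with $X_1+\cdots+X_n=m$ (all balls are distributed with no remainder), where $X_i$ is the number of balls in box $i$. The number of ways is the number of such tuples satisfying the stated constraints. Probabilities are with respect to the uniform distribution on the set of all such $n$-tuples. *)

theory Defs
  imports "HOL-Probability.Probability"
begin

text \<open>A tuple $(X_1,\dots,X_n)$ is a list of length $n$; box $i$ of the paper is entry \<open>X ! (i - 1)\<close>.\<close>

definition distributions :: "nat \<Rightarrow> nat \<Rightarrow> nat list set" where
  "distributions m n = {X. length X = n \<and> (\<Sum>i<n. X ! i) = m}"

definition at_most_per_box :: "nat \<Rightarrow> nat list set" where
  "at_most_per_box \<kappa> = {X. \<forall>i<length X. X ! i \<le> \<kappa>}"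

definition Omega :: "nat \<Rightarrow> nat \<Rightarrow> nat \<Rightarrow> nat" where
  "Omega m n \<kappa> = card (distributions m n \<inter> at_most_per_box \<kappa>)"

text \<open>\<open>pmf_of_set\<close> is the uniform distribution only on a finite nonempty set;
  \<open>distributions m n\<close> is always finite, and nonempty for \<open>n \<ge> 1\<close>.\<close>

definition Prob :: "nat \<Rightarrow> nat \<Rightarrow> nat \<Rightarrow> real" where
  "Prob m n \<kappa> = measure_pmf.prob (pmf_of_set (distributions m n)) (at_most_per_box \<kappa>)"

end

theory Submission
  imports Defs "HOL-Computational_Algebra.Formal_Power_Series"
begin

text \<open>\<open>Omega m n \<kappa>\<close> is the coefficient of \<open>x\<^sup>m\<close> in
  \<open>(1 + x + \<dots> + x\<^sup>\<kappa>)\<^sup>n = (1 - x\<^bsup>\<kappa> + 1\<^esup>)\<^sup>n / (1 - x)\<^sup>n\<close>. Expanding the numerator by the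
  binomial theorem gives the alternating sum, since the coefficients of \<open>1 / (1 - x)\<^sup>n\<close> count
  the unrestricted distributions.\<close>

text \<open>\<open>natpermute\<close> is the index set in the library's formula
  \<open>fps_power_nth\<close> for the coefficients of a power.\<close>

lemma distributions_eq_natpermute: "distributions m n = natpermute m n"
  by (auto simp: distributions_def natpermute_def sum_list_sum_nth atLeast0LessThan)

lemma finite_distributions: "finite (distributions m n)"
  by (simp add: distributions_eq_natpermute natpermute_finite)

lemma card_distributions:
  assumes "n \<ge> 1"
  shows "card (distributions m n) = (m + n - 1) choose (n - 1)"
proof -
  have "card (distributions m n) = (m + n - 1) choose m"
    unfolding distributions_eq_natpermute natpermute_def using card_length_sum_list[of n m]
    by (simp add: conj_commute)
  also have "\<dots> = (m + n - 1) choose (n - 1)"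
    using assms binomial_symmetric[of m "m + n - 1"] by simp
  finally show ?thesis .
qed

text \<open>Each tuple in the expansion of the \<open>n\<close>-th power contributes a product of
  0/1 factors, which is 1 exactly when all entries lie in \<open>A\<close>. \<open>A = UNIV\<close>
  gives the unrestricted count, \<open>A = {..\<kappa>}\<close> the capped one.\<close>

lemma indicator_fps_power_nth:
  fixes A :: "nat set"
  assumes "n \<ge> 1"
  shows "fps_nth (Abs_fps (\<lambda>k. of_bool (k \<in> A) :: int) ^ n) m
       = int (card (distributions m n \<inter> {X. \<forall>i<length X. X ! i \<in> A}))"
proof -
  have "fps_nth (Abs_fps (\<lambda>k. of_bool (k \<in> A) :: int) ^ n) m
      = (\<Sum>X\<in>distributions m n. \<Prod>i\<in>{0..n - 1}. of_bool (X ! i \<in> A))"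
    using assms by (simp add: fps_power_nth distributions_eq_natpermute)
  also have "\<dots> = (\<Sum>X\<in>distributions m n. of_bool (\<forall>i<length X. X ! i \<in> A))"
  proof (rule sum.cong)
    fix X assume "X \<in> distributions m n"
    then have "length X = n" by (simp add: distributions_def)
    moreover have "{0..n - 1} = {..<n}" using assms by auto
    ultimately show "(\<Prod>i\<in>{0..n - 1}. of_bool (X ! i \<in> A))
        = (of_bool (\<forall>i<length X. X ! i \<in> A) :: int)"
      by (auto simp: of_bool_def)
  qed simp
  finally show ?thesis
    by (simp add: finite_distributions Int_def)
qed

lemma Omega_eq_sum:
  assumes "n \<ge> 1"
  shows "int (Omega m n \<kappa>) = (\<Sum>\<alpha>\<le>m div (\<kappa> + 1).
           (- 1) ^ \<alpha> * int (n choose \<alpha>)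
           * int ((m - \<alpha> * (\<kappa> + 1) + n - 1) choose (n - 1)))"
proof -
  \<comment> \<open>\<open>G\<close> is the geometric series 1 / (1 - x), and \<open>T\<close> is
    its truncation after degree \<open>\<kappa>\<close>.\<close>
  define G :: "int fps" where "G = Abs_fps (\<lambda>_. 1)"
  define T :: "int fps" where "T = Abs_fps (\<lambda>k. of_bool (k \<in> {..\<kappa>}))"
  define c where "c \<alpha> = (- 1) ^ \<alpha> * int (n choose \<alpha>)" for \<alpha>
  define b where "b j = int ((j + n - 1) choose (n - 1))" for j
  have less_iff: "m < \<alpha> * (\<kappa> + 1) \<longleftrightarrow> \<not> \<alpha> \<le> m div (\<kappa> + 1)" for \<alpha>
    by (simp only: less_eq_div_iff_mult_less_eq add_gr_0 zero_less_one simp_thms not_le)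
  have G_nth: "fps_nth (G ^ n) j = b j" for j
    using indicator_fps_power_nth[OF assms, of UNIV j] card_distributions[OF assms]
    by (simp add: G_def b_def)
  \<comment> \<open>Subtracting the copy of \<open>G\<close> shifted by \<open>\<kappa> + 1\<close>
    cancels every coefficient above degree \<open>\<kappa>\<close>; no division of series is
    involved.\<close>
  have T_eq: "T = (1 - fps_X ^ (\<kappa> + 1)) * G"
  proof (rule fps_ext)
    fix k
    show "fps_nth T k = fps_nth ((1 - fps_X ^ (\<kappa> + 1)) * G) k"
      by (simp only: left_diff_distrib fps_sub_nth fps_X_power_mult_nth mult_1_left)
         (auto simp: T_def G_def)
  qed
  have "(1 - fps_X ^ (\<kappa> + 1)) ^ n = (\<Sum>\<alpha>\<le>n. of_nat (n choose \<alpha>) * (- (fps_X ^ (\<kappa> + 1))) ^ \<alpha> :: int fps)"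
    using binomial_ring[of "- (fps_X ^ (\<kappa> + 1))" "1 :: int fps" n] by simp
  also have "\<dots> = (\<Sum>\<alpha>\<le>n. fps_const (c \<alpha>) * fps_X ^ (\<alpha> * (\<kappa> + 1)))"
  proof (rule sum.cong)
    fix \<alpha>
    have "fps_const (c \<alpha>) = of_nat (n choose \<alpha>) * (- 1) ^ \<alpha>"
      by (simp add: c_def fps_of_nat flip: fps_const_mult fps_const_power fps_const_neg)
    then show "of_nat (n choose \<alpha>) * (- (fps_X ^ (\<kappa> + 1))) ^ \<alpha>
        = fps_const (c \<alpha>) * fps_X ^ (\<alpha> * (\<kappa> + 1))"
      by (simp only: power_minus[of "fps_X ^ (\<kappa> + 1)"] mult.assoc mult.commute[of \<alpha>] power_mult)
  qed simp
  finally have T_power: "T ^ n = (\<Sum>\<alpha>\<le>n. fps_const (c \<alpha>) * (fps_X ^ (\<alpha> * (\<kappa> + 1)) * G ^ n))"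
    by (simp only: T_eq power_mult_distrib sum_distrib_right mult.assoc)
  have "int (Omega m n \<kappa>) = fps_nth (T ^ n) m"
    using indicator_fps_power_nth[OF assms, of "{..\<kappa>}" m]
    by (simp add: Omega_def at_most_per_box_def T_def)
  \<comment> \<open>The factor \<open>fps_X ^ (\<alpha> * (\<kappa> + 1))\<close> shifts
    coefficients, so a shift beyond \<open>m\<close> contributes 0. The case distinction keeps the
    natural subtraction from truncating.\<close>
  also have "\<dots> = (\<Sum>\<alpha>\<le>n. if m < \<alpha> * (\<kappa> + 1) then 0 else c \<alpha> * b (m - \<alpha> * (\<kappa> + 1)))"
    unfolding T_power fps_sum_nth fps_mult_left_const_nth fps_X_power_mult_nth G_nth
    by (rule sum.cong) auto
  also have "\<dots> = (\<Sum>\<alpha>\<le>m div (\<kappa> + 1). c \<alpha> * b (m - \<alpha> * (\<kappa> + 1)))"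
  \<comment> \<open>Either range may be the longer one. Indices only in \<open>{..n}\<close> shift
    beyond \<open>m\<close>; indices only in \<open>{..m div (\<kappa> + 1)}\<close> exceed
    \<open>n\<close>, so \<open>n choose \<alpha>\<close> vanishes.\<close>
  proof (rule sum.mono_neutral_cong)
    show "(if m < \<alpha> * (\<kappa> + 1) then 0 else c \<alpha> * b (m - \<alpha> * (\<kappa> + 1))) = 0"
      if "\<alpha> \<in> {..n} - {..m div (\<kappa> + 1)}" for \<alpha>
      using that by (simp only: less_iff) simp
    show "(if m < \<alpha> * (\<kappa> + 1) then 0 else c \<alpha> * b (m - \<alpha> * (\<kappa> + 1)))
        = c \<alpha> * b (m - \<alpha> * (\<kappa> + 1))" if "\<alpha> \<in> {..n} \<inter> {..m div (\<kappa> + 1)}" for \<alpha>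
      using that by (simp only: less_iff) simp
  qed (auto simp: c_def binomial_eq_0)
  finally show ?thesis by (simp add: c_def b_def)
qed

theorem mainTheorem3:
  fixes m n \<kappa> :: nat
  assumes "n \<ge> 1" and "m \<ge> n"
    and "\<kappa> > 0"
    and "\<lceil>real m / real n\<rceil> \<le> int \<kappa>" and "\<kappa> < m"
  shows "int (Omega m n \<kappa>) =
           int ((m + n - 1) choose (n - 1))
           - (\<Sum>\<alpha> = 1..nat \<lfloor>real m / real (\<kappa> + 1)\<rfloor>.
                (- 1) ^ (\<alpha> + 1) * int (n choose \<alpha>)
                * int ((m - \<alpha> * (\<kappa> + 1) + n - 1) choose (n - 1)))
         \<and> Prob m n \<kappa> =
           1 - (\<Sum>\<alpha> = 1..nat \<lfloor>real m / real (\<kappa> + 1)\<rfloor>.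
                  (- 1) ^ (\<alpha> + 1) * real (n choose \<alpha>)
                  * real ((m - \<alpha> * (\<kappa> + 1) + n - 1) choose (n - 1)))
               / real ((m + n - 1) choose (n - 1))"
proof -
  define B where "B = (m + n - 1) choose (n - 1)"
  define S where "S = (\<Sum>\<alpha> = 1..m div (\<kappa> + 1). (- 1) ^ (\<alpha> + 1) * int (n choose \<alpha>)
                * int ((m - \<alpha> * (\<kappa> + 1) + n - 1) choose (n - 1)))"
  have floor: "nat \<lfloor>real m / real (\<kappa> + 1)\<rfloor> = m div (\<kappa> + 1)"
    by (simp only: floor_divide_of_nat_eq nat_int)
  \<comment> \<open>The term for \<open>\<alpha> = 0\<close> is the unrestricted count
    \<open>B\<close>; the others carry the sign opposite to that in \<open>S\<close>.\<close>
  have "{..m div (\<kappa> + 1)} = insert 0 {1..m div (\<kappa> + 1)}" by auto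
  then have Omega: "int (Omega m n \<kappa>) = int B - S"
    using Omega_eq_sum[OF assms(1), of m \<kappa>] by (simp add: B_def S_def sum_negf)
  have B: "card (distributions m n) = B" "B > 0"
    using assms(1) by (simp_all add: card_distributions B_def)
  \<comment> \<open>Nonemptiness and finiteness make \<open>pmf_of_set\<close> uniform, so the
    probability is a quotient of cardinalities.\<close>
  then have "distributions m n \<noteq> {}" by auto
  then have "Prob m n \<kappa> = real (Omega m n \<kappa>) / real B"
    by (simp add: Prob_def Omega_def measure_pmf_of_set finite_distributions B)
  also have "real (Omega m n \<kappa>) = real B - real_of_int S"
    using arg_cong[OF Omega, of real_of_int] by simp
  finally have "Prob m n \<kappa> = 1 - real_of_int S / real B"
    using B by (simp add: diff_divide_distrib)
  then show ?thesis
    using Omega unfolding floor by (simp add: B_def S_def)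
qed

end
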